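(* Let $K$ be a finite simplicial complex and let $L\subseteq K$ be a subcomplex. Then $TC(|K|,|L|)\leq TC(K,L)$, where $|\cdot|$ denotes geometric realization.
   Context: Simplicial complexes are abstract simplicial complexes. The categorical product $K\prod L$ of simplicial complexes has vertex set $V(K)\times V(L)$, and a finite set $\sigma$ of vertices is a simplex iff its projections $p_1(\sigma)$ and $p_2(\sigma)$ are simplices of $K$ and $L$ respectively. Two simplicial maps $\phi,\psi:K\to M$ are contiguous, $\phi\sim_c\psi$, if $\phi(\sigma)\cup\psi(\sigma)$ is a simplex of $M$ for every simplex $\sigma$ of $K$. They are in the same contiguity class, $\phi\sim\psi$, if there is a finite sequence of simplicial maps $\phi=\phi_0\sim_c\phi_1\sim_c\cdots\sim_c\phi_n=\psi$. For a subcomplex $L\subseteq K$, the targeted simplicial complexity $TC(K,L)$ is the least integer $n\ge 0$ such that $K\prod L$ can be covered by $n+1$ subcomplexes $\Omega_0,\dots,\Omega_n$ such that for each $i$ there is a simplicial map $\sigma_i:\Omega_i\to L$ with $\Delta_L\circ\sigma_i\sim i_{\Omega_i}$, where $\Delta_L:L\to K\prod L$, $\Delta_L(v)=(v,v)$, and $i_{\Omega_i}:\Omega_i\to K\prod L$ is the inclusion (and $TC(K,L)=\infty$ if no such $n$ exists). For a topological space $X$ and a subspace $Y\subseteq X$, the relative topological complexity $TC(X,Y)$ is the Švarc genus of the fibration $\pi:P(X,Y)\to X\times Y$, $\pi(\gamma)=(\gamma(0),\gamma(1))$, where $P(X,Y)$ is the space (compact-open topology) of paths $\gamma:[0,1]\to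 X$ with $\gamma(1)\in Y$. The Švarc genus of a map $f:A\to B$ is the least $n\ge0$ such that $B$ is covered by open sets $V_0,\dots,V_n$, each admitting a continuous $s_j:V_j\to A$ with $f\circ s_j$ equal to the inclusion $V_j\hookrightarrow B$ (and $\infty$ if no such $n$ exists). *)

theory Defs
  imports "HOL-Analysis.Analysis" "HOL-Library.Extended_Nat"
begin

section \<open>Abstract simplicial complexes\<close>

text \<open>A complex is given by its set of simplices, which are finite and nonempty. The name
  \<open>simplicial_complex\<close> is taken by the geometric complexes of \<open>HOL-Analysis.Polytope\<close>.\<close>

definition abstract_complex :: "'a set set \<Rightarrow> bool" where
  "abstract_complex K \<longleftrightarrow>
     (\<forall>\<sigma>\<in>K. finite \<sigma> \<and> \<sigma> \<noteq> {}) \<and>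
     (\<forall>\<sigma>\<in>K. \<forall>\<tau>. \<tau> \<subseteq> \<sigma> \<and> \<tau> \<noteq> {} \<longrightarrow> \<tau> \<in> K)"

definition subcomplex :: "'a set set \<Rightarrow> 'a set set \<Rightarrow> bool" where
  "subcomplex L K \<longleftrightarrow> abstract_complex L \<and> L \<subseteq> K"

text \<open>Every vertex spans a simplex, so \<open>\<Union>K\<close> is the vertex set of \<open>K\<close>.\<close>

definition categorical_prod :: "'a set set \<Rightarrow> 'b set set \<Rightarrow> ('a \<times> 'b) set set" where
  "categorical_prod K L =
     {\<sigma>. finite \<sigma> \<and> \<sigma> \<subseteq> \<Union>K \<times> \<Union>L \<and> fst ` \<sigma> \<in> K \<and> snd ` \<sigma> \<in> L}"

text \<open>Simplicial maps are vertex maps; their values outside the vertex set play no role.\<close>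

definition simplicial_map :: "'a set set \<Rightarrow> 'b set set \<Rightarrow> ('a \<Rightarrow> 'b) \<Rightarrow> bool" where
  "simplicial_map K M \<phi> \<longleftrightarrow> (\<forall>\<sigma>\<in>K. \<phi> ` \<sigma> \<in> M)"

definition contiguous :: "'a set set \<Rightarrow> 'b set set \<Rightarrow> ('a \<Rightarrow> 'b) \<Rightarrow> ('a \<Rightarrow> 'b) \<Rightarrow> bool" where
  "contiguous K M \<phi> \<psi> \<longleftrightarrow> (\<forall>\<sigma>\<in>K. \<phi> ` \<sigma> \<union> \<psi> ` \<sigma> \<in> M)"

definition same_contiguity_class ::
    "'a set set \<Rightarrow> 'b set set \<Rightarrow> ('a \<Rightarrow> 'b) \<Rightarrow> ('a \<Rightarrow> 'b) \<Rightarrow> bool" where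
  "same_contiguity_class K M \<phi> \<psi> \<longleftrightarrow>
     (\<exists>(n::nat) \<theta>. \<theta> 0 = \<phi> \<and> \<theta> n = \<psi> \<and>
        (\<forall>i\<le>n. simplicial_map K M (\<theta> i)) \<and>
        (\<forall>i<n. contiguous K M (\<theta> i) (\<theta> (Suc i))))"

text \<open>The infimum of a nonempty set of extended naturals is its least element, and
  \<open>Inf {} = \<infinity>\<close>. The inclusion of \<open>\<Omega> i\<close> is the identity on vertices. Covering means that
  every simplex of the product lies in one of the \<open>\<Omega> i\<close>.\<close>

definition simplicial_TC :: "'a set set \<Rightarrow> 'a set set \<Rightarrow> enat" where
  "simplicial_TC K L =
     Inf {enat n | n. \<exists>\<Omega> :: nat \<Rightarrow> ('a \<times> 'a) set set.
       (\<forall>i\<le>n. subcomplex (\<Omega> i) (categorical_prod K L)) \<and>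
       (\<Union>i\<le>n. \<Omega> i) = categorical_prod K L \<and>
       (\<forall>i\<le>n. \<exists>\<sigma>. simplicial_map (\<Omega> i) L \<sigma> \<and>
          same_contiguity_class (\<Omega> i) (categorical_prod K L) ((\<lambda>v. (v, v)) \<circ> \<sigma>) id)}"


section \<open>Geometric realization\<close>

text \<open>Points are given by barycentric coordinates; \<open>{v. t v \<noteq> 0}\<close> is the carrier of \<open>t\<close>.\<close>

definition realization_set :: "'a set set \<Rightarrow> ('a \<Rightarrow> real) set" where
  "realization_set K =
     {t. (\<forall>v. 0 \<le> t v) \<and> {v. t v \<noteq> 0} \<in> K \<and> (\<Sum>v\<in>{v. t v \<noteq> 0}. t v) = 1}"

definition closed_simplex :: "'a set \<Rightarrow> ('a \<Rightarrow> real) set" where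
  "closed_simplex \<sigma> =
     {t. (\<forall>v. 0 \<le> t v) \<and> {v. t v \<noteq> 0} \<subseteq> \<sigma> \<and> (\<Sum>v\<in>\<sigma>. t v) = 1}"

text \<open>The coherent (weak) topology. Coordinates outside \<open>\<sigma>\<close> vanish on \<open>closed_simplex \<sigma>\<close>, so
  the product topology induces on it the Euclidean topology of a simplex.\<close>

definition realization :: "'a set set \<Rightarrow> ('a \<Rightarrow> real) topology" where
  "realization K = topology (\<lambda>U. U \<subseteq> realization_set K \<and>
     (\<forall>\<sigma>\<in>K. openin (subtopology (powertop_real UNIV) (closed_simplex \<sigma>))
                (U \<inter> closed_simplex \<sigma>)))"

lemma openin_realization:
  "openin (realization K) U \<longleftrightarrow> U \<subseteq> realization_set K \<and>
     (\<forall>\<sigma>\<in>K. openin (subtopology (powertop_real UNIV) (closed_simplex \<sigma>))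
                (U \<inter> closed_simplex \<sigma>))"
proof -
  have "istopology (\<lambda>U. U \<subseteq> realization_set K \<and>
     (\<forall>\<sigma>\<in>K. openin (subtopology (powertop_real UNIV) (closed_simplex \<sigma>))
                (U \<inter> closed_simplex \<sigma>)))" (is "istopology ?P")
    unfolding istopology_def
  proof (intro conjI allI impI)
    fix S T assume S: "?P S" and T: "?P T"
    show "S \<inter> T \<subseteq> realization_set K" using S by blast
    show "\<forall>\<sigma>\<in>K. openin (subtopology (powertop_real UNIV) (closed_simplex \<sigma>))
                (S \<inter> T \<inter> closed_simplex \<sigma>)"
    proof
      fix \<sigma> assume "\<sigma> \<in> K"
      then have "openin (subtopology (powertop_real UNIV) (closed_simplex \<sigma>))
                   ((S \<inter> closed_simplex \<sigma>) \<inter> (T \<inter> closed_simplex \<sigma>))"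
        using S T by (blast intro: openin_Int)
      moreover have "(S \<inter> closed_simplex \<sigma>) \<inter> (T \<inter> closed_simplex \<sigma>) = S \<inter> T \<inter> closed_simplex \<sigma>"
        by blast
      ultimately show "openin (subtopology (powertop_real UNIV) (closed_simplex \<sigma>))
                (S \<inter> T \<inter> closed_simplex \<sigma>)" by metis
    qed
  next
    fix \<U> assume *: "\<forall>S\<in>\<U>. ?P S"
    then show "\<Union>\<U> \<subseteq> realization_set K" by blast
    show "\<forall>\<sigma>\<in>K. openin (subtopology (powertop_real UNIV) (closed_simplex \<sigma>))
                (\<Union>\<U> \<inter> closed_simplex \<sigma>)"
    proof
      fix \<sigma> assume "\<sigma> \<in> K"
      then have "openin (subtopology (powertop_real UNIV) (closed_simplex \<sigma>))
                   (\<Union>S\<in>\<U>. S \<inter> closed_simplex \<sigma>)"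
        using * by (intro openin_Union) blast
      moreover have "(\<Union>S\<in>\<U>. S \<inter> closed_simplex \<sigma>) = \<Union>\<U> \<inter> closed_simplex \<sigma>" by blast
      ultimately show "openin (subtopology (powertop_real UNIV) (closed_simplex \<sigma>))
                (\<Union>\<U> \<inter> closed_simplex \<sigma>)" by metis
    qed
  qed
  then show ?thesis
    unfolding realization_def by (simp add: topology_inverse')
qed

lemma realization_set_eq_Union:
  assumes "abstract_complex K"
  shows "realization_set K = (\<Union>\<sigma>\<in>K. closed_simplex \<sigma>)"
proof (intro subset_antisym subsetI)
  fix t assume "t \<in> realization_set K"
  then show "t \<in> (\<Union>\<sigma>\<in>K. closed_simplex \<sigma>)"
    unfolding realization_set_def closed_simplex_def by blast
next
  fix t assume "t \<in> (\<Union>\<sigma>\<in>K. closed_simplex \<sigma>)"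
  then obtain \<sigma> where \<sigma>: "\<sigma> \<in> K" and t: "\<forall>v. 0 \<le> t v" "{v. t v \<noteq> 0} \<subseteq> \<sigma>" "sum t \<sigma> = 1"
    unfolding closed_simplex_def by blast
  have "finite \<sigma>" using assms \<sigma> by (auto simp: abstract_complex_def)
  then have "sum t {v. t v \<noteq> 0} = sum t \<sigma>"
    using t(2) by (rule sum.mono_neutral_left) blast
  with t(3) have s: "sum t {v. t v \<noteq> 0} = 1" by metis
  then have "{v. t v \<noteq> 0} \<noteq> {}" by (metis sum.empty zero_neq_one)
  then have "{v. t v \<noteq> 0} \<in> K"
    using assms \<sigma> t(2) unfolding abstract_complex_def by blast
  with s t(1) show "t \<in> realization_set K" by (simp add: realization_set_def)
qed

lemma topspace_realization:
  assumes "abstract_complex K"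
  shows "topspace (realization K) = realization_set K"
proof -
  have "realization_set K \<inter> closed_simplex \<sigma> = closed_simplex \<sigma>" if "\<sigma> \<in> K" for \<sigma>
    using that realization_set_eq_Union[OF assms] by blast
  moreover have "openin (subtopology (powertop_real UNIV) C) C" for C :: "('a \<Rightarrow> real) set"
    using openin_topspace[of "subtopology (powertop_real UNIV) C"] by simp
  ultimately have "openin (realization K) (realization_set K)"
    by (simp add: openin_realization)
  then show ?thesis
    by (metis openin_realization openin_subset openin_topspace subset_antisym)
qed


section \<open>Relative topological complexity\<close>

text \<open>Continuous maps are made extensional, so that they are determined by their values
  on \<open>topspace X\<close>.\<close>

definition continuous_maps :: "'a topology \<Rightarrow> 'b topology \<Rightarrow> ('a \<Rightarrow> 'b) set" where
  "continuous_maps X Y = {f. continuous_map X Y f \<and> f \<in> extensional (topspace X)}"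

definition compact_open_topology :: "'a topology \<Rightarrow> 'b topology \<Rightarrow> ('a \<Rightarrow> 'b) topology" where
  "compact_open_topology X Y =
     topology_generated_by
       {{f \<in> continuous_maps X Y. f ` C \<subseteq> U} | C U. compactin X C \<and> openin Y U}"

lemma topspace_compact_open_topology:
  "topspace (compact_open_topology X Y) = continuous_maps X Y"
proof -
  have "\<exists>C U. continuous_maps X Y = {f \<in> continuous_maps X Y. f ` C \<subseteq> U} \<and>
              compactin X C \<and> openin Y U"
    by (intro exI[of _ "{}"]) auto
  then show ?thesis
    unfolding compact_open_topology_def topology_generated_by_topspace by blast
qed

definition path_space_ending_in :: "'a topology \<Rightarrow> 'a set \<Rightarrow> (real \<Rightarrow> 'a) topology" where
  "path_space_ending_in X Y =
     subtopology (compact_open_topology (top_of_set {0..1}) X) {\<gamma>. \<gamma> 1 \<in> Y}"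

definition svarc_genus :: "'a topology \<Rightarrow> 'b topology \<Rightarrow> ('a \<Rightarrow> 'b) \<Rightarrow> enat" where
  "svarc_genus A B f =
     Inf {enat n | n. \<exists>V :: nat \<Rightarrow> 'b set.
       (\<forall>j\<le>n. openin B (V j)) \<and>
       (\<Union>j\<le>n. V j) = topspace B \<and>
       (\<forall>j\<le>n. \<exists>s. continuous_map (subtopology B (V j)) A s \<and> (\<forall>b\<in>V j. f (s b) = b))}"

definition relative_TC :: "'a topology \<Rightarrow> 'a set \<Rightarrow> enat" where
  "relative_TC X Y =
     svarc_genus (path_space_ending_in X Y) (prod_topology X (subtopology X Y))
       (\<lambda>\<gamma>. (\<gamma> 0, \<gamma> 1))"

end

theory Submission
  imports Defs
begin

text \<open>
  Why the inequality holds. Let \<open>\<Omega>\<close> be one of the subcomplexes covering \<open>K \<Prod> L\<close>, with a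
  contiguity chain from \<open>\<Delta> \<circ> \<sigma>\<close> to the inclusion. Its two coordinates are chains from \<open>\<sigma>\<close> to
  the two projections, so running one of them backwards and then the other forwards connects
  \<open>fst\<close> to \<open>snd\<close> by contiguous vertex maps \<open>\<Omega> \<rightarrow> K\<close> (\<open>contiguity_of_projections\<close>).
  Contiguous maps send a point of \<open>|\<Omega>|\<close> into a common simplex of \<open>K\<close>, so a point \<open>r\<close> of
  \<open>|\<Omega>|\<close> determines a polygonal path in \<open>|K|\<close> from the first projection of \<open>r\<close> to the second.

  A pair \<open>(x, y)\<close> in \<open>|K| \<times> |L|\<close> gives the point \<open>z\<close> of the realization of \<open>K \<Prod> L\<close> with
  coordinates \<open>x v * y w\<close>, whose projections are \<open>x\<close> and \<open>y\<close>. The pairs for which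
  \<open>z\<close> lies in \<open>|\<Omega>|\<close> only form a closed set, whereas an open one is needed. The remedy is to
  discard small coordinates. Fix \<open>\<epsilon> > 0\<close> so small that the coordinates of a point cannot
  all be at most \<open>\<epsilon>\<close>; finiteness of \<open>K\<close> makes this possible. The set of all pairs
  for which the superlevel set \<open>{p. \<epsilon> \<le> z p}\<close> is a simplex of \<open>\<Omega>\<close> is open, because superlevel
  sets can only shrink under small perturbations (\<open>openin_superlevel_nbhd\<close>). These sets cover,
  because the superlevel set is a face of the carrier of \<open>z\<close> (\<open>superlevel_nbhd_cover\<close>).
  Replacing the coordinates by \<open>max 0 (z p - \<epsilon>)\<close> and normalizing moves \<open>z\<close> continuously to a
  point \<open>r\<close> of \<open>|\<Omega>|\<close> carried by that face (\<open>superlevel_set\<close>).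

  The path assigned to \<open>(x, y)\<close> is then the polygon that starts at \<open>x\<close>, visits the images of
  \<open>r\<close> under the maps of the chain, and ends at \<open>y\<close>. Its first and last edges stay in the carriers
  of \<open>x\<close> and of \<open>y\<close>, since truncation does not enlarge the carrier (\<open>motion_planner\<close>). Joint
  continuity of the polygon in the pair and the time gives continuity into the path space by
  the tube lemma (\<open>continuous_map_curry_compact_open\<close>). So each \<open>\<Omega>\<close> yields an open set with a
  section, and the number of sets does not change.
\<close>


section \<open>Contiguity classes\<close>

lemma contiguous_sym: "contiguous K M \<phi> \<psi> \<Longrightarrow> contiguous K M \<psi> \<phi>"
  by (simp add: contiguous_def Un_commute)

lemma same_contiguity_class_sym:
  assumes "same_contiguity_class K M \<phi> \<psi>"
  shows "same_contiguity_class K M \<psi> \<phi>"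
proof -
  obtain n :: nat and \<theta> where \<theta>: "\<theta> 0 = \<phi>" "\<theta> n = \<psi>"
    "\<forall>i\<le>n. simplicial_map K M (\<theta> i)" "\<forall>i<n. contiguous K M (\<theta> i) (\<theta> (Suc i))"
    using assms unfolding same_contiguity_class_def by blast
  have "contiguous K M (\<theta> (n - i)) (\<theta> (n - Suc i))" if "i < n" for i
  proof -
    have "n - i = Suc (n - Suc i)" using that by simp
    moreover have "contiguous K M (\<theta> (n - Suc i)) (\<theta> (Suc (n - Suc i)))"
      using \<theta>(4) that by simp
    ultimately show ?thesis by (metis contiguous_sym)
  qed
  then show ?thesis
    unfolding same_contiguity_class_def
    using \<theta> by (intro exI[of _ n] exI[of _ "\<lambda>i. \<theta> (n - i)"]) auto
qed

lemma same_contiguity_class_trans: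
  assumes "same_contiguity_class K M \<phi> \<psi>" and "same_contiguity_class K M \<psi> \<omega>"
  shows "same_contiguity_class K M \<phi> \<omega>"
proof -
  obtain m :: nat and \<theta> where \<theta>: "\<theta> 0 = \<phi>" "\<theta> m = \<psi>"
    "\<forall>i\<le>m. simplicial_map K M (\<theta> i)" "\<forall>i<m. contiguous K M (\<theta> i) (\<theta> (Suc i))"
    using assms(1) unfolding same_contiguity_class_def by blast
  obtain n :: nat and \<eta> where \<eta>: "\<eta> 0 = \<psi>" "\<eta> n = \<omega>"
    "\<forall>i\<le>n. simplicial_map K M (\<eta> i)" "\<forall>i<n. contiguous K M (\<eta> i) (\<eta> (Suc i))"
    using assms(2) unfolding same_contiguity_class_def by blast
  define \<zeta> where "\<zeta> i = (if i < m then \<theta> i else \<eta> (i - m))" for i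
  have *: "\<zeta> i = \<theta> i" if "i \<le> m" for i
    using that \<theta>(2) \<eta>(1) by (auto simp: \<zeta>_def)
  have "contiguous K M (\<zeta> i) (\<zeta> (Suc i))" if "i < m + n" for i
  proof (cases "i < m")
    case True
    then show ?thesis using *[of i] *[of "Suc i"] \<theta>(4) by simp
  next
    case False
    then show ?thesis using \<eta>(4) that by (simp add: \<zeta>_def Suc_diff_le)
  qed
  moreover have "simplicial_map K M (\<zeta> i)" if "i \<le> m + n" for i
    using that \<theta>(3) \<eta>(3) by (simp add: \<zeta>_def)
  moreover have "\<zeta> 0 = \<phi>" "\<zeta> (m + n) = \<omega>"
    using *[of 0] \<theta>(1) \<eta>(2) by (simp_all add: \<zeta>_def)
  ultimately show ?thesis
    unfolding same_contiguity_class_def by blast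
qed

lemma same_contiguity_class_compose:
  assumes "same_contiguity_class K M \<phi> \<psi>" and f: "simplicial_map M N f"
  shows "same_contiguity_class K N (f \<circ> \<phi>) (f \<circ> \<psi>)"
proof -
  obtain n :: nat and \<theta> where \<theta>: "\<theta> 0 = \<phi>" "\<theta> n = \<psi>"
    "\<forall>i\<le>n. simplicial_map K M (\<theta> i)" "\<forall>i<n. contiguous K M (\<theta> i) (\<theta> (Suc i))"
    using assms(1) unfolding same_contiguity_class_def by blast
  have "(f \<circ> \<theta> i) ` \<sigma> \<union> (f \<circ> \<theta> j) ` \<sigma> = f ` (\<theta> i ` \<sigma> \<union> \<theta> j ` \<sigma>)" for i j \<sigma>
    by (simp add: image_Un image_comp)
  then have "\<forall>i<n. contiguous K N (f \<circ> \<theta> i) (f \<circ> \<theta> (Suc i))"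
    using \<theta>(4) f by (simp add: contiguous_def simplicial_map_def)
  moreover have "\<forall>i\<le>n. simplicial_map K N (f \<circ> \<theta> i)"
    using \<theta>(3) f by (metis image_comp simplicial_map_def)
  ultimately show ?thesis
    unfolding same_contiguity_class_def
    using \<theta>(1,2) by (intro exI[of _ n] exI[of _ "\<lambda>i. f \<circ> \<theta> i"]) auto
qed

text \<open>The composites of \<open>\<Delta> \<circ> \<sigma>\<close> with the two projections are both \<open>\<sigma>\<close>, so \<open>\<sigma>\<close> is a common
  member of the contiguity classes of \<open>fst\<close> and \<open>snd\<close>.\<close>

lemma contiguity_of_projections:
  assumes "L \<subseteq> K"
    and "same_contiguity_class \<Omega> (categorical_prod K L) ((\<lambda>v. (v, v)) \<circ> \<sigma>) id"
  shows "same_contiguity_class \<Omega> K fst snd"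
proof -
  have "simplicial_map (categorical_prod K L) K fst" "simplicial_map (categorical_prod K L) K snd"
    using assms(1) by (auto simp: simplicial_map_def categorical_prod_def)
  then have "same_contiguity_class \<Omega> K (fst \<circ> ((\<lambda>v. (v, v)) \<circ> \<sigma>)) (fst \<circ> id)"
    "same_contiguity_class \<Omega> K (snd \<circ> ((\<lambda>v. (v, v)) \<circ> \<sigma>)) (snd \<circ> id)"
    using same_contiguity_class_compose[OF assms(2)] by blast+
  moreover have "fst \<circ> ((\<lambda>v. (v, v)) \<circ> \<sigma>) = snd \<circ> ((\<lambda>v. (v, v)) \<circ> \<sigma>)"
    by auto
  ultimately show ?thesis
    by (metis comp_id same_contiguity_class_sym same_contiguity_class_trans)
qed


section \<open>Realizations of finite complexes\<close>

lemma closed_simplex_mono: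
  assumes "finite \<tau>" "\<sigma> \<subseteq> \<tau>" "t \<in> closed_simplex \<sigma>"
  shows "t \<in> closed_simplex \<tau>"
proof -
  have "sum t \<sigma> = sum t \<tau>"
    using assms by (intro sum.mono_neutral_left) (auto simp: closed_simplex_def)
  then show ?thesis using assms by (auto simp: closed_simplex_def)
qed

lemma realization_set_subset_closed_simplex:
  assumes "abstract_complex K" "finite K"
  shows "realization_set K \<subseteq> closed_simplex (\<Union>K)"
proof -
  have "finite (\<Union>K)" using assms by (auto simp: abstract_complex_def)
  then show ?thesis
    unfolding realization_set_eq_Union[OF assms(1)] using closed_simplex_mono by blast
qed

lemma closed_simplex_convex:
  assumes "p \<in> closed_simplex \<sigma>" "q \<in> closed_simplex \<sigma>" "0 \<le> a" "0 \<le> b" "a + b = 1"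
  shows "(\<lambda>v. a * p v + b * q v) \<in> closed_simplex \<sigma>"
proof -
  have "(\<Sum>v\<in>\<sigma>. a * p v + b * q v) = a * sum p \<sigma> + b * sum q \<sigma>"
    by (simp add: sum.distrib sum_distrib_left)
  moreover have "a * p v + b * q v = 0" if "v \<notin> \<sigma>" for v
  proof -
    have "p v = 0" "q v = 0" using that assms(1,2) unfolding closed_simplex_def by blast+
    then show ?thesis by simp
  qed
  ultimately show ?thesis using assms by (auto simp: closed_simplex_def)
qed

lemma closed_closed_simplex: "closed (closed_simplex \<sigma> :: ('a \<Rightarrow> real) set)"
proof -
  have "closed_simplex \<sigma> =
      (\<Inter>v. {t. 0 \<le> t v}) \<inter> (\<Inter>v\<in>-\<sigma>. {t. t v = 0}) \<inter> {t :: 'a \<Rightarrow> real. (\<Sum>v\<in>\<sigma>. t v) = 1}"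
    by (auto simp: closed_simplex_def)
  moreover have "closed \<dots>"
    by (intro closed_Int closed_INT ballI closed_Collect_le closed_Collect_eq continuous_intros)
       auto
  ultimately show ?thesis by metis
qed

text \<open>For a finite complex the weak topology is the subspace topology: a subset of \<open>|K|\<close> that is
  closed in every simplex is a finite union of closed sets, as simplices are closed in the
  product topology. Continuity into \<open>|K|\<close> can therefore be tested coordinatewise.\<close>

lemma realization_finite:
  assumes K: "abstract_complex K" and "finite K"
  shows "realization K = top_of_set (realization_set K)"
proof (rule topology_eq[THEN iffD2], intro allI iffI)
  fix U assume "openin (realization K) U"
  then have U: "U \<subseteq> realization_set K"
    "\<And>\<sigma>. \<sigma> \<in> K \<Longrightarrow> openin (top_of_set (closed_simplex \<sigma>)) (U \<inter> closed_simplex \<sigma>)"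
    by (auto simp: openin_realization euclidean_product_topology)
  have "closed (closed_simplex \<sigma> - U)" if "\<sigma> \<in> K" for \<sigma>
  proof -
    have "closedin (top_of_set (closed_simplex \<sigma>)) (closed_simplex \<sigma> - U \<inter> closed_simplex \<sigma>)"
      using U(2)[OF that] by (intro closedin_diff) auto
    then have "closed (closed_simplex \<sigma> - U \<inter> closed_simplex \<sigma>)"
      by (rule closedin_closed_trans) (rule closed_closed_simplex)
    moreover have "closed_simplex \<sigma> - U \<inter> closed_simplex \<sigma> = closed_simplex \<sigma> - U" by blast
    ultimately show ?thesis by simp
  qed
  then have "closed (\<Union>\<sigma>\<in>K. closed_simplex \<sigma> - U)"
    using \<open>finite K\<close> by (intro closed_UN) auto
  moreover have "(\<Union>\<sigma>\<in>K. closed_simplex \<sigma> - U) = realization_set K - U"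
    by (auto simp: realization_set_eq_Union[OF K])
  ultimately have "open (- (realization_set K - U))"
    by (metis open_Compl)
  moreover have "U = realization_set K \<inter> - (realization_set K - U)" using U(1) by blast
  ultimately show "openin (top_of_set (realization_set K)) U"
    by (metis openin_open)
next
  fix U assume "openin (top_of_set (realization_set K)) U"
  then obtain T where T: "open T" "U = realization_set K \<inter> T"
    by (auto simp: openin_open)
  have "U \<inter> closed_simplex \<sigma> = closed_simplex \<sigma> \<inter> T" if "\<sigma> \<in> K" for \<sigma>
    using that T(2) by (auto simp: realization_set_eq_Union[OF K])
  then show "openin (realization K) U"
    using T by (auto simp: openin_realization euclidean_product_topology openin_open)
qed

text \<open>Realization of a vertex map \<open>g\<close>: weights are added along the fibres of \<open>g\<close>. Summing over a
  fixed finite vertex set \<open>F\<close>, and not over the varying carrier of \<open>r\<close>, makes continuity in \<open>r\<close>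
  evident.\<close>

definition pushforward :: "'a set \<Rightarrow> ('a \<Rightarrow> 'b) \<Rightarrow> ('a \<Rightarrow> real) \<Rightarrow> 'b \<Rightarrow> real" where
  "pushforward F g r w = (\<Sum>p\<in>F. if g p = w then r p else 0)"

lemma pushforward_in_closed_simplex:
  assumes "finite F" "\<rho> \<subseteq> F" "r \<in> closed_simplex \<rho>"
  shows "pushforward F g r \<in> closed_simplex (g ` \<rho>)"
proof -
  have r: "0 \<le> r p" "p \<notin> \<rho> \<Longrightarrow> r p = 0" "sum r \<rho> = 1" for p
    using assms(3) by (auto simp: closed_simplex_def)
  have fin: "finite (g ` \<rho>)" using assms finite_subset by blast
  have "(\<Sum>w\<in>g ` \<rho>. pushforward F g r w) = (\<Sum>p\<in>F. \<Sum>w\<in>g ` \<rho>. if g p = w then r p else 0)"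
    unfolding pushforward_def by (rule sum.swap)
  also have "\<dots> = (\<Sum>p\<in>F. if g p \<in> g ` \<rho> then r p else 0)"
    using fin by simp
  also have "\<dots> = sum r \<rho>"
    using assms r(2) by (intro sum.mono_neutral_cong_right) auto
  finally have "(\<Sum>w\<in>g ` \<rho>. pushforward F g r w) = 1" using r(3) by simp
  moreover have "pushforward F g r w = 0" if "w \<notin> g ` \<rho>" for w
    unfolding pushforward_def using that r(2) by (intro sum.neutral) auto
  moreover have "0 \<le> pushforward F g r w" for w
    unfolding pushforward_def using r(1) by (intro sum_nonneg) auto
  ultimately show ?thesis by (auto simp: closed_simplex_def)
qed

lemma continuous_on_pushforward:
  assumes "\<And>p. p \<in> F \<Longrightarrow> continuous_on S (\<lambda>b. r b p)"
  shows "continuous_on S (\<lambda>b. pushforward F g (r b))"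
proof (rule continuous_on_coordinatewise_then_product)
  fix w
  have "continuous_on S (\<lambda>b. if g p = w then r b p else 0)" if "p \<in> F" for p
    using assms[OF that] by (cases "g p = w") auto
  then show "continuous_on S (\<lambda>b. pushforward F g (r b) w)"
    unfolding pushforward_def by (intro continuous_on_sum)
qed


section \<open>Truncating barycentric coordinates\<close>

definition truncate :: "'a set \<Rightarrow> real \<Rightarrow> ('a \<Rightarrow> real) \<Rightarrow> 'a \<Rightarrow> real" where
  "truncate F \<epsilon> z p = max 0 (z p - \<epsilon>) / (\<Sum>q\<in>F. max 0 (z q - \<epsilon>))"

text \<open>The cutoff \<open>\<epsilon>\<close> is below \<open>1 / card F\<close>, so by pigeonhole some coordinate of \<open>z\<close> exceeds it.
  Hence the superlevel set is nonempty and the normalizing sum is positive. The truncated point is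
  supported on \<open>\<epsilon> < z p\<close>, whereas the superlevel set uses \<open>\<epsilon> \<le> z p\<close>: the weak inequality
  is what makes membership of the superlevel set in a complex an open condition on \<open>z\<close>.\<close>

lemma superlevel_set:
  assumes "finite F" "z \<in> closed_simplex F" "0 < \<epsilon>" "real (card F) * \<epsilon> < 1"
  shows "{p. \<epsilon> \<le> z p} \<subseteq> F" "{p. \<epsilon> \<le> z p} \<noteq> {}"
    and "0 < (\<Sum>q\<in>F. max 0 (z q - \<epsilon>))"
    and "truncate F \<epsilon> z \<in> closed_simplex {p. \<epsilon> \<le> z p}"
proof -
  have z: "0 \<le> z p" "p \<notin> F \<Longrightarrow> z p = 0" "sum z F = 1" for p
    using assms(2) by (auto simp: closed_simplex_def)
  show sub: "{p. \<epsilon> \<le> z p} \<subseteq> F" 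
  proof
    fix p assume "p \<in> {p. \<epsilon> \<le> z p}"
    then show "p \<in> F" using z(2)[of p] assms(3) by fastforce
  qed
  have "\<exists>p\<in>F. \<epsilon> < z p"
  proof (rule ccontr)
    assume "\<not> ?thesis"
    then have "sum z F \<le> real (card F) * \<epsilon>" by (intro sum_bounded_above) auto
    with z(3) assms(4) show False by simp
  qed
  then obtain p where p: "p \<in> F" "\<epsilon> < z p" by blast
  then have "p \<in> {p. \<epsilon> \<le> z p}" by simp
  then show "{p. \<epsilon> \<le> z p} \<noteq> {}" by blast
  have "max 0 (z p - \<epsilon>) \<le> (\<Sum>q\<in>F. max 0 (z q - \<epsilon>))"
    using p assms(1) by (intro member_le_sum) auto
  with p show pos: "0 < (\<Sum>q\<in>F. max 0 (z q - \<epsilon>))" by simp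
  have "(\<Sum>q | \<epsilon> \<le> z q. max 0 (z q - \<epsilon>)) = (\<Sum>q\<in>F. max 0 (z q - \<epsilon>))"
    using sub assms(1) by (intro sum.mono_neutral_left) auto
  then have "(\<Sum>q | \<epsilon> \<le> z q. truncate F \<epsilon> z q) = 1"
    using pos by (simp add: truncate_def flip: sum_divide_distrib)
  then show "truncate F \<epsilon> z \<in> closed_simplex {p. \<epsilon> \<le> z p}"
    using pos by (auto simp: closed_simplex_def truncate_def)
qed

text \<open>The product measure of two points, viewed as probability measures on the vertices. It is a
  section of the canonical map from the realization of the categorical product to the product of
  the realizations.\<close>

definition product_point :: "('a \<Rightarrow> real) \<times> ('b \<Rightarrow> real) \<Rightarrow> 'a \<times> 'b \<Rightarrow> real" where
  "product_point b p = fst b (fst p) * snd b (snd p)"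

lemma product_point_in_closed_simplex:
  assumes "x \<in> closed_simplex \<sigma>" "y \<in> closed_simplex \<tau>"
  shows "product_point (x, y) \<in> closed_simplex (\<sigma> \<times> \<tau>)"
proof -
  have "(\<Sum>p\<in>\<sigma> \<times> \<tau>. product_point (x, y) p) = sum x \<sigma> * sum y \<tau>"
    by (simp add: product_point_def sum_product sum.cartesian_product case_prod_beta)
  then show ?thesis using assms by (auto simp: closed_simplex_def product_point_def)
qed

lemma continuous_on_product_point:
  "continuous_on S (\<lambda>b :: ('a \<Rightarrow> real) \<times> ('b \<Rightarrow> real). product_point b p)"
proof -
  have "continuous_on UNIV (\<lambda>b :: ('a \<Rightarrow> real) \<times> ('b \<Rightarrow> real). fst b v)"
       "continuous_on UNIV (\<lambda>b :: ('a \<Rightarrow> real) \<times> ('b \<Rightarrow> real). snd b w)" for v w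
    by (rule continuous_on_product_then_coordinatewise, intro continuous_intros)+
  then have "continuous_on UNIV (\<lambda>b :: ('a \<Rightarrow> real) \<times> ('b \<Rightarrow> real). product_point b p)"
    unfolding product_point_def by (intro continuous_on_mult)
  then show ?thesis by (rule continuous_on_subset) simp
qed


section \<open>Families of polygonal paths\<close>

text \<open>Currying is continuous for the compact-open topology. For a compact \<open>C\<close> and an open \<open>U\<close>,
  the tube lemma (\<open>Wallace_theorem_prod_topology\<close>) thickens a slice \<open>{b} \<times> C\<close> inside the
  preimage of \<open>U\<close> to a strip \<open>N \<times> C\<close>, and all parameters in \<open>N\<close> then satisfy the subbasic
  condition given by \<open>C\<close> and \<open>U\<close>.\<close>

lemma continuous_map_curry_compact_open:
  assumes "continuous_map (prod_topology B T) X (\<lambda>(b, t). h b t)"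
  shows "continuous_map B (compact_open_topology T X) (\<lambda>b. restrict (h b) (topspace T))"
    (is "continuous_map _ _ ?h")
proof -
  have maps: "?h b \<in> continuous_maps T X" if "b \<in> topspace B" for b
  proof -
    have "continuous_map T (prod_topology B T) (\<lambda>t. (b, t))"
      using that by (simp add: continuous_map_pairedI)
    then have "continuous_map T X (h b)"
      using continuous_map_compose[OF _ assms] by (fastforce simp: o_def)
    then show ?thesis
      by (simp add: continuous_maps_def continuous_map_eq)
  qed
  show ?thesis
    unfolding compact_open_topology_def
  proof (rule continuous_on_generated_topo)
    fix W assume "W \<in> {{f \<in> continuous_maps T X. f ` C \<subseteq> U} |C U. compactin T C \<and> openin X U}"
    then obtain C U where W: "W = {f \<in> continuous_maps T X. f ` C \<subseteq> U}"
      and C: "compactin T C" and U: "openin X U" by blast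
    define G where "G = {p \<in> topspace (prod_topology B T). (\<lambda>(b, t). h b t) p \<in> U}"
    have G: "openin (prod_topology B T) G"
      unfolding G_def using assms U by (rule openin_continuous_map_preimage)
    have CT: "C \<subseteq> topspace T" using C by (rule compactin_subset_topspace)
    show "openin B (?h -` W \<inter> topspace B)"
    proof (subst openin_subopen, intro ballI)
      fix b assume b: "b \<in> ?h -` W \<inter> topspace B"
      then have "{b} \<times> C \<subseteq> G" using CT by (auto simp: W G_def)
      then obtain N M where N: "openin B N" "{b} \<subseteq> N" "C \<subseteq> M" "N \<times> M \<subseteq> G"
        using Wallace_theorem_prod_topology[OF _ C G] b by (metis IntD2 compactin_sing)
      have "?h b' \<in> W" if "b' \<in> N" for b'
      proof -
        have "b' \<in> topspace B" using N(1) that openin_subset by blast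
        moreover have "h b' t \<in> U" if "t \<in> C" for t
        proof -
          have "(b', t) \<in> G" using N(3,4) \<open>b' \<in> N\<close> that by blast
          then show ?thesis by (simp add: G_def)
        qed
        ultimately show ?thesis using maps CT by (auto simp: W)
      qed
      then show "\<exists>N. openin B N \<and> b \<in> N \<and> N \<subseteq> ?h -` W \<inter> topspace B"
        using N(1,2) openin_subset[OF N(1)] by (intro exI[of _ N]) blast
    qed
  next
    have "?h ` topspace B \<subseteq> continuous_maps T X" using maps by blast
    moreover have "continuous_maps T X \<in>
      {{f \<in> continuous_maps T X. f ` C \<subseteq> U} |C U. compactin T C \<and> openin X U}"
      by (intro CollectI exI[of _ "{}"] exI[of _ "{}"]) auto
    ultimately show "?h ` topspace B
      \<subseteq> \<Union>{{f \<in> continuous_maps T X. f ` C \<subseteq> U} |C U. compactin T C \<and> openin X U}"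
      by blast
  qed
qed

text \<open>The path through \<open>q 0\<close>, ..., \<open>q N\<close> at times \<open>j / N\<close>, linear in between. Writing it as a
  sum of hat functions in place of a case distinction on \<open>t\<close> makes joint continuity in \<open>t\<close> and the
  vertices immediate.\<close>

definition polygon :: "nat \<Rightarrow> (nat \<Rightarrow> 'a \<Rightarrow> real) \<Rightarrow> real \<Rightarrow> 'a \<Rightarrow> real" where
  "polygon N q t v = (\<Sum>j\<le>N. max 0 (1 - \<bar>N * t - j\<bar>) * q j v)"

lemma polygon_on_edge:
  assumes "k < N" "real k \<le> N * t" "N * t \<le> real k + 1"
  shows "polygon N q t v = (1 - (N * t - k)) * q k v + (N * t - k) * q (Suc k) v"
proof -
  have "polygon N q t v = (\<Sum>j\<in>{k, Suc k}. max 0 (1 - \<bar>N * t - j\<bar>) * q j v)"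
    unfolding polygon_def
  proof (rule sum.mono_neutral_right)
    show "\<forall>j\<in>{..N} - {k, Suc k}. max 0 (1 - \<bar>N * t - j\<bar>) * q j v = 0"
    proof
      fix j assume "j \<in> {..N} - {k, Suc k}"
      then have "j + 1 \<le> k \<or> k + 2 \<le> j" by auto
      then have "real j + 1 \<le> real k \<or> real k + 2 \<le> real j"
        by (metis of_nat_1 of_nat_add of_nat_le_iff of_nat_numeral)
      then have "1 - \<bar>N * t - j\<bar> \<le> 0" using assms by linarith
      then show "max 0 (1 - \<bar>N * t - j\<bar>) * q j v = 0" by simp
    qed
  qed (use assms in auto)
  moreover have "max 0 (1 - \<bar>N * t - k\<bar>) = 1 - (N * t - k)"
    "max 0 (1 - \<bar>N * t - Suc k\<bar>) = N * t - k"
    using assms by auto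
  ultimately show ?thesis by simp
qed

lemma polygon_endpoints:
  assumes "0 < N"
  shows "polygon N q 0 = q 0" "polygon N q 1 = q N"
proof -
  show "polygon N q 0 = q 0"
    using polygon_on_edge[of 0 N 0 q] assms by (intro ext) simp
  show "polygon N q 1 = q N"
    using polygon_on_edge[of "N - 1" N 1 q] assms by (intro ext) (simp add: of_nat_diff)
qed

lemma polygon_in_realization:
  assumes K: "abstract_complex K" and N: "0 < N" and t: "t \<in> {0..1}"
    and q: "\<And>j. j < N \<Longrightarrow> \<exists>\<sigma>\<in>K. q j \<in> closed_simplex \<sigma> \<and> q (Suc j) \<in> closed_simplex \<sigma>"
  shows "polygon N q t \<in> realization_set K"
proof -
  have "\<exists>k<N. real k \<le> N * t \<and> N * t \<le> real k + 1"
  proof (cases "t = 1")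
    case True
    then show ?thesis using N by (intro exI[of _ "N - 1"]) (simp add: of_nat_diff)
  next
    case False
    then have "0 \<le> N * t" "N * t < N" using t N by auto
    then show ?thesis
      by (intro exI[of _ "nat \<lfloor>N * t\<rfloor>"]) (auto simp: nat_less_iff floor_less_iff; linarith)
  qed
  then obtain k where k: "k < N" "real k \<le> N * t" "N * t \<le> real k + 1" by blast
  obtain \<sigma> where \<sigma>: "\<sigma> \<in> K" "q k \<in> closed_simplex \<sigma>" "q (Suc k) \<in> closed_simplex \<sigma>"
    using q[OF k(1)] by blast
  have "(\<lambda>v. (1 - (N * t - k)) * q k v + (N * t - k) * q (Suc k) v) \<in> closed_simplex \<sigma>"
    using \<sigma> k by (intro closed_simplex_convex) auto
  then have "polygon N q t \<in> closed_simplex \<sigma>"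
    by (simp add: polygon_on_edge[OF k, abs_def])
  then show ?thesis using \<sigma>(1) realization_set_eq_Union[OF K] by blast
qed

text \<open>Since \<open>q 0 b\<close> and \<open>q N b\<close> are the ends of the path over \<open>b\<close>, a section of the path
  fibration over \<open>S\<close> amounts to a family \<open>q\<close> with \<open>q 0 = fst\<close> and \<open>q N = snd\<close>. The \<open>edge\<close>
  hypothesis keeps the polygon inside \<open>|K|\<close> by convexity of simplices.\<close>

lemma polygonal_section:
  fixes q :: "nat \<Rightarrow> 'b::topological_space \<Rightarrow> 'a \<Rightarrow> real"
  assumes K: "abstract_complex K" "finite K" and N: "0 < N"
    and cont: "\<And>j. j \<le> N \<Longrightarrow> continuous_on S (q j)"
    and edge: "\<And>b j. b \<in> S \<Longrightarrow> j < N \<Longrightarrow>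
      \<exists>\<sigma>\<in>K. q j b \<in> closed_simplex \<sigma> \<and> q (Suc j) b \<in> closed_simplex \<sigma>"
    and Y: "\<And>b. b \<in> S \<Longrightarrow> q N b \<in> Y"
  shows "\<exists>s. continuous_map (top_of_set S) (path_space_ending_in (realization K) Y) s \<and>
    (\<forall>b\<in>S. s b 0 = q 0 b \<and> s b 1 = q N b)"
proof -
  define h where "h b = polygon N (\<lambda>j. q j b)" for b
  define s where "s b = restrict (h b) {0..1}" for b
  have "continuous_on (S \<times> {0..1}) (\<lambda>p. h (fst p) (snd p))"
  proof (rule continuous_on_coordinatewise_then_product)
    fix v
    have "continuous_on (S \<times> {0..1}) (\<lambda>p. q j (fst p) v)" if "j \<le> N" for j
      by (rule continuous_on_compose2[OF continuous_on_product_then_coordinatewise[OF cont[OF that]]])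
         (auto intro: continuous_intros)
    then show "continuous_on (S \<times> {0..1}) (\<lambda>p. h (fst p) (snd p) v)"
      unfolding h_def polygon_def by (intro continuous_intros) auto
  qed
  moreover have "h b t \<in> realization_set K" if "b \<in> S" "t \<in> {0..1}" for b t
    unfolding h_def using K(1) N that(2) edge[OF that(1)] by (rule polygon_in_realization)
  ultimately have "continuous_map (prod_topology (top_of_set S) (top_of_set {0..1}))
      (realization K) (\<lambda>(b, t). h b t)"
    by (auto simp: realization_finite[OF K] case_prod_beta continuous_map_in_subtopology)
  from continuous_map_curry_compact_open[OF this]
  have "continuous_map (top_of_set S) (compact_open_topology (top_of_set {0..1}) (realization K)) s"
    by (simp add: s_def[abs_def])
  moreover have ends: "s b 0 = q 0 b \<and> s b 1 = q N b" for b
    by (simp add: s_def h_def polygon_endpoints[OF N])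
  ultimately have "continuous_map (top_of_set S) (path_space_ending_in (realization K) Y) s"
    using Y by (auto simp: path_space_ending_in_def continuous_map_in_subtopology)
  then show ?thesis using ends by blast
qed


section \<open>The open cover and its motion planners\<close>

definition superlevel_nbhd ::
    "'a set set \<Rightarrow> 'a set set \<Rightarrow> real \<Rightarrow> ('a \<times> 'a) set set \<Rightarrow> (('a \<Rightarrow> real) \<times> ('a \<Rightarrow> real)) set" where
  "superlevel_nbhd K L \<epsilon> \<Omega> =
     {b \<in> realization_set K \<times> realization_set L. {p. \<epsilon> \<le> product_point b p} \<in> \<Omega>}"

lemma product_point_in_vertex_simplex:
  assumes "abstract_complex K" "finite K" "abstract_complex L" "finite L"
    and "b \<in> realization_set K \<times> realization_set L"
  shows "product_point b \<in> closed_simplex (\<Union>K \<times> \<Union>L)"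
  using assms realization_set_subset_closed_simplex[of K] realization_set_subset_closed_simplex[of L]
  by (cases b) (auto intro!: product_point_in_closed_simplex)

lemma openin_superlevel_nbhd:
  assumes K: "abstract_complex K" "finite K" and L: "abstract_complex L" "finite L"
    and \<Omega>: "abstract_complex \<Omega>" and \<epsilon>: "0 < \<epsilon>" "real (card (\<Union>K \<times> \<Union>L)) * \<epsilon> < 1"
  shows "openin (top_of_set (realization_set K \<times> realization_set L)) (superlevel_nbhd K L \<epsilon> \<Omega>)"
proof -
  define F where "F = \<Union>K \<times> \<Union>L"
  have F: "finite F" using K L by (auto simp: F_def abstract_complex_def)
  \<comment> \<open>The superlevel set of \<open>b\<close> is contained in \<open>\<tau>\<close> iff finitely many coordinates are
    below \<open>\<epsilon>\<close>, and it belongs to \<open>\<Omega>\<close> iff it is contained in some simplex \<open>\<tau>\<close> of \<open>\<Omega>\<close>.\<close>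
  define W where "W = (\<Union>\<tau>\<in>\<Omega>. \<Inter>p\<in>F - \<tau>. {b. product_point b p < \<epsilon>})"
  have "open W"
    unfolding W_def using F
    by (intro open_UN ballI open_INT open_Collect_less continuous_on_product_point continuous_on_const)
       auto
  moreover have "superlevel_nbhd K L \<epsilon> \<Omega> = (realization_set K \<times> realization_set L) \<inter> W"
  proof -
    have "{p. \<epsilon> \<le> product_point b p} \<in> \<Omega> \<longleftrightarrow> b \<in> W"
      if b: "b \<in> realization_set K \<times> realization_set L" for b
    proof -
      have z: "product_point b \<in> closed_simplex F"
        unfolding F_def using K L b by (rule product_point_in_vertex_simplex)
      have sup: "{p. \<epsilon> \<le> product_point b p} \<subseteq> F" "{p. \<epsilon> \<le> product_point b p} \<noteq> {}"
        using superlevel_set(1,2)[OF F z \<epsilon>(1)] \<epsilon>(2) by (auto simp: F_def)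
      have "b \<in> W \<longleftrightarrow> (\<exists>\<tau>\<in>\<Omega>. {p. \<epsilon> \<le> product_point b p} \<subseteq> \<tau>)"
      proof -
        have "{p. \<epsilon> \<le> product_point b p} \<subseteq> \<tau> \<longleftrightarrow> (\<forall>p\<in>F - \<tau>. \<not> \<epsilon> \<le> product_point b p)" for \<tau>
          using sup(1) by blast
        then show ?thesis by (simp add: W_def not_le)
      qed
      then show ?thesis using \<Omega> sup(2) unfolding abstract_complex_def by blast
    qed
    then show ?thesis unfolding superlevel_nbhd_def by blast
  qed
  ultimately show ?thesis by (auto simp: openin_open)
qed

text \<open>The carriers of \<open>x\<close> and \<open>y\<close> span a product simplex, which lies in one of the \<open>\<Omega> i\<close> by
  hypothesis; the superlevel set of \<open>(x, y)\<close> is a face of it.\<close>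

lemma superlevel_nbhd_cover:
  assumes K: "abstract_complex K" "finite K" and L: "abstract_complex L" "finite L"
    and \<Omega>: "\<And>i. i \<in> I \<Longrightarrow> abstract_complex (\<Omega> i)"
    and cover: "(\<Union>i\<in>I. \<Omega> i) = categorical_prod K L"
    and \<epsilon>: "0 < \<epsilon>" "real (card (\<Union>K \<times> \<Union>L)) * \<epsilon> < 1"
  shows "(\<Union>i\<in>I. superlevel_nbhd K L \<epsilon> (\<Omega> i)) = realization_set K \<times> realization_set L"
proof (intro subset_antisym subsetI)
  fix b assume b: "b \<in> realization_set K \<times> realization_set L"
  have F: "finite (\<Union>K \<times> \<Union>L)" using K L by (auto simp: abstract_complex_def)
  have sup: "{p. \<epsilon> \<le> product_point b p} \<noteq> {}"
    using superlevel_set(2)[OF F product_point_in_vertex_simplex[OF K L b] \<epsilon>] .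
  obtain x y where xy: "b = (x, y)" by force
  define \<sigma> where "\<sigma> = {v. x v \<noteq> 0}"
  define \<tau> where "\<tau> = {v. y v \<noteq> 0}"
  have \<sigma>\<tau>: "\<sigma> \<in> K" "\<tau> \<in> L"
    using b by (simp_all add: xy \<sigma>_def \<tau>_def realization_set_def)
  then have "\<sigma> \<noteq> {}" "\<tau> \<noteq> {}" "finite \<sigma>" "finite \<tau>"
    using K(1) L(1) unfolding abstract_complex_def by blast+
  moreover have "\<sigma> \<times> \<tau> \<subseteq> \<Union>K \<times> \<Union>L" using \<sigma>\<tau> by blast
  ultimately have "\<sigma> \<times> \<tau> \<in> categorical_prod K L"
    using \<sigma>\<tau> by (simp add: categorical_prod_def)
  then obtain i where i: "i \<in> I" "\<sigma> \<times> \<tau> \<in> \<Omega> i" using cover by blast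
  have "{p. \<epsilon> \<le> product_point b p} \<subseteq> \<sigma> \<times> \<tau>"
    using \<epsilon>(1) by (auto simp: xy \<sigma>_def \<tau>_def product_point_def)
  then have "{p. \<epsilon> \<le> product_point b p} \<in> \<Omega> i"
    using i \<Omega>[OF i(1)] sup unfolding abstract_complex_def by blast
  then show "b \<in> (\<Union>i\<in>I. superlevel_nbhd K L \<epsilon> (\<Omega> i))"
    using i(1) b by (auto simp: superlevel_nbhd_def)
qed (auto simp: superlevel_nbhd_def)

text \<open>Over the open set given by \<open>\<Omega>\<close>, the chain from \<open>fst\<close> to \<open>snd\<close> supplies all vertices of
  the polygon except the first and the last, which are the prescribed ends \<open>x\<close> and \<open>y\<close>.\<close>

lemma motion_planner:
  assumes K: "abstract_complex K" "finite K" and L: "subcomplex L K"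
    and contig: "same_contiguity_class \<Omega> K fst snd"
    and \<epsilon>: "0 < \<epsilon>" "real (card (\<Union>K \<times> \<Union>L)) * \<epsilon> < 1"
  shows "\<exists>s. continuous_map (top_of_set (superlevel_nbhd K L \<epsilon> \<Omega>))
      (path_space_ending_in (realization K) (realization_set L)) s \<and>
    (\<forall>b\<in>superlevel_nbhd K L \<epsilon> \<Omega>. s b 0 = fst b \<and> s b 1 = snd b)"
proof -
  have L': "abstract_complex L" "finite L" "L \<subseteq> K"
    using L finite_subset[OF _ K(2), of L] by (simp_all add: subcomplex_def)
  define F where "F = \<Union>K \<times> \<Union>L"
  have F: "finite F" using K L' by (auto simp: F_def abstract_complex_def)
  let ?V = "superlevel_nbhd K L \<epsilon> \<Omega>"
  let ?\<rho> = "\<lambda>b. {p. \<epsilon> \<le> product_point b p}"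
  obtain n :: nat and g where g: "g 0 = fst" "g n = snd"
    "\<forall>i\<le>n. simplicial_map \<Omega> K (g i)" "\<forall>i<n. contiguous \<Omega> K (g i) (g (Suc i))"
    using contig unfolding same_contiguity_class_def by blast
  define r where "r b = truncate F \<epsilon> (product_point b)"
    for b :: "('a \<Rightarrow> real) \<times> ('a \<Rightarrow> real)"
  have V: "b \<in> realization_set K \<times> realization_set L" "?\<rho> b \<in> \<Omega>" "?\<rho> b \<subseteq> F"
    "r b \<in> closed_simplex (?\<rho> b)" "0 < (\<Sum>q\<in>F. max 0 (product_point b q - \<epsilon>))"
    if "b \<in> ?V" for b
  proof -
    show b: "b \<in> realization_set K \<times> realization_set L" "?\<rho> b \<in> \<Omega>"
      using that by (auto simp: superlevel_nbhd_def)
    have z: "product_point b \<in> closed_simplex F"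
      unfolding F_def using K L'(1,2) b(1) by (rule product_point_in_vertex_simplex)
    show "?\<rho> b \<subseteq> F" "r b \<in> closed_simplex (?\<rho> b)"
      "0 < (\<Sum>q\<in>F. max 0 (product_point b q - \<epsilon>))"
      using superlevel_set[OF F z \<epsilon>(1)] \<epsilon>(2) by (auto simp: F_def r_def)
  qed
  have cont_r: "continuous_on ?V (\<lambda>b. r b p)" for p
    unfolding r_def truncate_def using V(5)
    by (intro continuous_intros continuous_on_product_point) force
  have push: "pushforward F (g i) (r b) \<in> closed_simplex (g i ` ?\<rho> b)" if "b \<in> ?V" for b i
    using F V(3,4)[OF that] by (rule pushforward_in_closed_simplex)
  \<comment> \<open>The chain \<open>g\<close> has \<open>n + 1\<close> members; with the two ends this gives \<open>n + 3\<close> vertices, hence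
    \<open>n + 2\<close> edges, and \<open>g i\<close> sits at position \<open>i + 1\<close>.\<close>
  define q where "q j b = (if j = 0 then fst b else if j = n + 2 then snd b
    else pushforward F (g (j - 1)) (r b))" for j b
  have "continuous_on ?V (q j)" for j
    unfolding q_def
    by (cases "j = 0"; cases "j = n + 2")
       (auto intro!: continuous_on_pushforward cont_r
          continuous_on_fst continuous_on_snd continuous_on_id)
  moreover have "\<exists>\<sigma>\<in>K. q j b \<in> closed_simplex \<sigma> \<and> q (Suc j) b \<in> closed_simplex \<sigma>"
    if b: "b \<in> ?V" and j: "j < n + 2" for b j
  proof -
    obtain x y where xy: "b = (x, y)" by force
    define \<sigma> where "\<sigma> = {v. x v \<noteq> 0}"
    define \<tau> where "\<tau> = {v. y v \<noteq> 0}"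
    have \<sigma>\<tau>: "\<sigma> \<in> K" "\<tau> \<in> L" "x \<in> closed_simplex \<sigma>" "y \<in> closed_simplex \<tau>"
      using V(1)[OF b] by (auto simp: xy \<sigma>_def \<tau>_def realization_set_def closed_simplex_def)
    have fin: "finite \<sigma>" "finite \<tau>"
      using \<sigma>\<tau>(1,2) K(1) L'(1) unfolding abstract_complex_def by blast+
    have sub: "?\<rho> b \<subseteq> \<sigma> \<times> \<tau>"
      using \<epsilon>(1) by (auto simp: xy \<sigma>_def \<tau>_def product_point_def)
    consider "j = 0" | "j = n + 1" | i where "j = Suc i" "i < n"
      using j by (metis Suc_eq_plus1 add_2_eq_Suc' less_SucE less_Suc_eq_0_disj
          not0_implies_Suc Suc_less_eq)
    then show ?thesis
    proof cases
      case 1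
      \<comment> \<open>\<open>g 0 = fst\<close>, and \<open>fst\<close> sends the superlevel set into the carrier of \<open>x\<close>.\<close>
      have "pushforward F (g 0) (r b) \<in> closed_simplex \<sigma>"
        using push[OF b, of 0] sub by (intro closed_simplex_mono[OF fin(1)]) (auto simp: g(1))
      then show ?thesis using \<sigma>\<tau> 1 by (auto simp: q_def xy)
    next
      case 2
      have "pushforward F (g n) (r b) \<in> closed_simplex \<tau>"
        using push[OF b, of n] sub by (intro closed_simplex_mono[OF fin(2)]) (auto simp: g(2))
      then show ?thesis using \<sigma>\<tau> L'(3) 2 by (auto simp: q_def xy)
    next
      case 3
      let ?\<upsilon> = "g i ` ?\<rho> b \<union> g (Suc i) ` ?\<rho> b"
      have \<upsilon>: "?\<upsilon> \<in> K" using g(4) 3(2) V(2)[OF b] by (auto simp: contiguous_def)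
      then have "finite ?\<upsilon>" using K(1) unfolding abstract_complex_def by blast
      then have "pushforward F (g i) (r b) \<in> closed_simplex ?\<upsilon>"
        "pushforward F (g (Suc i)) (r b) \<in> closed_simplex ?\<upsilon>"
        using push[OF b] by (auto intro: closed_simplex_mono)
      then show ?thesis using \<upsilon> 3 by (intro bexI[OF _ \<upsilon>]) (simp add: q_def)
    qed
  qed
  moreover have "q (n + 2) b \<in> realization_set L" if "b \<in> ?V" for b
    using V(1)[OF that] by (auto simp: q_def)
  ultimately have "\<exists>s. continuous_map (top_of_set ?V)
      (path_space_ending_in (realization K) (realization_set L)) s \<and>
      (\<forall>b\<in>?V. s b 0 = q 0 b \<and> s b 1 = q (n + 2) b)"
    by (intro polygonal_section[OF K]) auto
  then show ?thesis by (simp add: q_def)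
qed

theorem theorem5p1:
  fixes K L :: "'a set set"
  assumes "abstract_complex K" and "finite K" and "subcomplex L K"
  shows "relative_TC (realization K) (realization_set L) \<le> simplicial_TC K L"
proof -
  have L: "abstract_complex L" "finite L" "L \<subseteq> K"
    using assms(3) finite_subset[OF _ assms(2), of L] by (simp_all add: subcomplex_def)
  \<comment> \<open>Adding 1 makes the product with the cardinality strictly less than 1, and avoids
    division by zero when one of the complexes is empty.\<close>
  define \<epsilon> :: real where "\<epsilon> = 1 / (card (\<Union>K \<times> \<Union>L) + 1)"
  have \<epsilon>: "0 < \<epsilon>" "real (card (\<Union>K \<times> \<Union>L)) * \<epsilon> < 1"
    by (simp_all add: \<epsilon>_def)
  have "realization_set L \<subseteq> realization_set K"
    using L(3) by (auto simp: realization_set_def)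
  then have B: "prod_topology (realization K) (subtopology (realization K) (realization_set L))
      = top_of_set (realization_set K \<times> realization_set L)"
    by (simp add: realization_finite[OF assms(1,2)] subtopology_subtopology inf.absorb2)
  show ?thesis
    unfolding relative_TC_def svarc_genus_def simplicial_TC_def B
  proof (rule Inf_superset_mono, safe)
    fix n and \<Omega> :: "nat \<Rightarrow> ('a \<times> 'a) set set"
    assume \<Omega>: "\<forall>i\<le>n. subcomplex (\<Omega> i) (categorical_prod K L)"
      and cover: "(\<Union>i\<le>n. \<Omega> i) = categorical_prod K L"
      and maps: "\<forall>i\<le>n. \<exists>\<sigma>. simplicial_map (\<Omega> i) L \<sigma> \<and>
          same_contiguity_class (\<Omega> i) (categorical_prod K L) ((\<lambda>v. (v, v)) \<circ> \<sigma>) id"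
    let ?V = "\<lambda>i. superlevel_nbhd K L \<epsilon> (\<Omega> i)"
    have \<Omega>': "abstract_complex (\<Omega> i)" if "i \<le> n" for i
      using \<Omega> that by (auto simp: subcomplex_def)
    have "openin (top_of_set (realization_set K \<times> realization_set L)) (?V i)" if "i \<le> n" for i
      using assms(1,2) L(1,2) \<Omega>'[OF that] \<epsilon> by (rule openin_superlevel_nbhd)
    moreover have "(\<Union>i\<le>n. ?V i) = realization_set K \<times> realization_set L"
      using assms(1,2) L(1,2) _ cover \<epsilon> by (rule superlevel_nbhd_cover) (use \<Omega>' in auto)
    moreover have "\<exists>s. continuous_map
          (subtopology (top_of_set (realization_set K \<times> realization_set L)) (?V i))
          (path_space_ending_in (realization K) (realization_set L)) s \<and>
        (\<forall>b\<in>?V i. (s b 0, s b 1) = b)" if i: "i \<le> n" for i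
    proof -
      have "same_contiguity_class (\<Omega> i) K fst snd"
        using maps i contiguity_of_projections[OF L(3)] by blast
      then obtain s where "continuous_map (top_of_set (?V i))
          (path_space_ending_in (realization K) (realization_set L)) s"
        "\<forall>b\<in>?V i. s b 0 = fst b \<and> s b 1 = snd b"
        using motion_planner[OF assms _ \<epsilon>] by meson
      moreover have "subtopology (top_of_set (realization_set K \<times> realization_set L)) (?V i)
          = top_of_set (?V i)"
        by (simp add: subtopology_subtopology inf.absorb2 superlevel_nbhd_def subset_iff)
      ultimately show ?thesis by auto
    qed
    ultimately show "\<exists>m. enat n = enat m \<and> (\<exists>V.
        (\<forall>j\<le>m. openin (top_of_set (realization_set K \<times> realization_set L)) (V j)) \<and>
        (\<Union>j\<le>m. V j) = topspace (top_of_set (realization_set K \<times> realization_set L)) \<and>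
        (\<forall>j\<le>m. \<exists>s. continuous_map
            (subtopology (top_of_set (realization_set K \<times> realization_set L)) (V j))
            (path_space_ending_in (realization K) (realization_set L)) s \<and>
          (\<forall>b\<in>V j. (s b 0, s b 1) = b)))"
      by (intro exI[of _ n] conjI refl exI[of _ ?V]) simp_all
  qed
qed

end
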